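(* Let $\vec w\in\mathcal{O}_D$ be a distinct vector, with associated angle $a=a_{\vec w}$, fundamental domain $F=F_{\vec w}$ and cone $F_{a/4}$. Let $K\subset\mathcal{U}_d$ be such that there exists a compact convex set $K'\subset F_{a/4}$ with $q:K'\to K$ a homeomorphism. Then the Fréchet mean $\mu_K$ of $K$ is unique and satisfies $q(\mu_{K'})=\mu_K$. That is: for every probability distribution $Q$ supported on $K'$, with (Euclidean) Fréchet mean $\mu_{K'}$, the pushforward distribution $q_*Q$, supported on $K$, has a unique Fréchet mean $\mu_K$ in $\mathcal{U}_d$ with respect to the Procrustean distance $d_P$, and $\mu_K=q(\mu_{K'})$.
   Context: Let $D=\binom d2$ and $\mathcal{O}_D=\{\vec x\in\mathbb{R}^D: x^i\ge0\}$, whose coordinates are indexed by the edges $\{i,j\}$, $1\le i<j\le d$ (vectors of edge weights of labeled undirected networks on $d$ vertices). The group $\Sigma_d$ of permutations of $\{1,\dots,d\}$ acts on $\mathcal{O}_D$ by $(\sigma\cdot\vec x)_{\{i,j\}}=\vec x_{\{\sigma^{-1}(i),\sigma^{-1}(j)\}}$. The space of unlabeled networks is $\mathcal{U}_d=\mathcal{O}_D/\Sigma_d$ with the quotient topology and projection $q:\mathcal{O}_D\to\mathcal{U}_d$, $q(\vec x)=[\vec x]$. With $d_E$ Euclidean distance, the Procrustean distance is $d_P([\vec x],[\vec y])=\min_{\sigma_1,\sigma_2\in\Sigma_d}d_E(\sigma_1\cdot\vec x,\sigma_2\cdot\vec y)$. A vector $\vec w\in\mathcal{O}_D$ is distinct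 if $\sigma\cdot\vec w\ne\vec w$ for all $\sigma\in\Sigma_d$, $\sigma\neq\mathrm{id}$. For distinct $\vec w$: $F_{\vec w}=\{\vec w'\in\mathcal{O}_D: d_E(\vec w,\vec w')\le d_E(\vec w,\sigma\cdot\vec w')\ \forall\sigma\in\Sigma_d\}$; $a=a_{\vec w}$ is the smallest angle between $\vec w$ and $\sigma\cdot\vec w$ over $\sigma\in\Sigma_d$, $\sigma\ne\mathrm{id}$; and $F_c$ denotes the solid cone in $\mathcal{O}_D$ with vertex at the origin, axis $\vec w$ and cone angle $c$, i.e. the set of $\vec u\in\mathcal{O}_D$ that are $\vec 0$ or make an angle at most $c$ with $\vec w$. For a Borel probability distribution $P$ on a metric space $(M,\rho)$, a Fréchet mean of $P$ is a minimizer over $p\in M$ of the Fréchet function $\int_M\rho^2(p,z)\,P(dz)$. For $Q$ on $K'$, the Euclidean Fréchet mean $\mu_{K'}$ is the center of mass $\int_{K'}\vec y\,Q(d\vec y)$. *)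

theory Defs
  imports "HOL-Probability.Probability" "HOL-Library.Cardinality"
begin

section \<open>Edge weight vectors and relabelling\<close>

text \<open>The vertex set is a finite type \<open>'n\<close> with \<open>d = CARD('n) \<ge> 2\<close> elements (class \<open>card2\<close>; the
  bound is what makes the type of edges nonempty).  An edge is an unordered pair of distinct
  vertices.\<close>

typedef (overloaded) 'n edge = "{e :: 'n::card2 set. card e = 2}"
  morphisms endpoints Edge
proof -
  have "\<exists>e\<subseteq>(UNIV :: 'n set). card e = 2"
    using two_le_card[where 'a = 'n] by (metis obtain_subset_with_card_n)
  then show ?thesis by auto
qed

instance edge :: (card2) finite
proof
  have "inj (endpoints :: 'a edge \<Rightarrow> 'a set)"
    by (simp add: endpoints_inject inj_on_def)
  then show "finite (UNIV :: 'a edge set)"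
    by (metis finite finite_imageD)
qed

lemma CARD_edge: "CARD('n::card2 edge) = CARD('n) choose 2"
proof -
  have "bij_betw endpoints (UNIV :: 'n edge set) {e. e \<subseteq> UNIV \<and> card e = 2}"
    using type_definition.Rep_range[OF type_definition_edge[where 'n = 'n]]
    by (auto simp: bij_betw_def inj_on_def endpoints_inject)
  then show ?thesis
    using n_subsets[OF finite, of "UNIV :: 'n set" 2] bij_betw_same_card by fastforce
qed

type_synonym 'n weights = "real ^ 'n edge"

definition orthant :: "'n::card2 weights set" where
  "orthant = {x. \<forall>e. 0 \<le> x $ e}"

definition map_edge :: "('n::card2 \<Rightarrow> 'n) \<Rightarrow> 'n edge \<Rightarrow> 'n edge" where
  "map_edge f e = Edge (f ` endpoints e)"

lemma endpoints_map_edge: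
  assumes "bij f"
  shows "endpoints (map_edge f e) = f ` endpoints e"
proof -
  have "card (f ` endpoints e) = 2"
    using endpoints[of e] assms by (auto simp: card_image bij_def inj_on_def)
  then show ?thesis
    by (simp add: map_edge_def Edge_inverse)
qed

text \<open>The group of vertex permutations is the set of bijections \<open>'n \<Rightarrow> 'n\<close>.\<close>

definition relabel :: "('n::card2 \<Rightarrow> 'n) \<Rightarrow> 'n weights \<Rightarrow> 'n weights" where
  "relabel \<sigma> x = (\<chi> e. x $ map_edge (inv \<sigma>) e)"

lemma relabel_orthant: "x \<in> orthant \<Longrightarrow> relabel \<sigma> x \<in> orthant"
  by (simp add: orthant_def relabel_def)

lemma relabel_id: "relabel id x = x"
  by (simp add: relabel_def map_edge_def endpoints_inverse vec_eq_iff)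

lemma relabel_comp:
  assumes "bij \<sigma>" "bij \<tau>"
  shows "relabel (\<sigma> \<circ> \<tau>) x = relabel \<sigma> (relabel \<tau> x)"
proof -
  have "map_edge (inv (\<sigma> \<circ> \<tau>)) e = map_edge (inv \<tau>) (map_edge (inv \<sigma>) e)" for e
    using assms
    by (simp add: endpoints_inject[symmetric] endpoints_map_edge bij_imp_bij_inv bij_comp
        o_inv_distrib image_comp)
  then show ?thesis
    by (simp add: relabel_def vec_eq_iff)
qed


section \<open>Unlabeled networks\<close>

definition network_of :: "'n::card2 weights \<Rightarrow> 'n weights set" where
  "network_of x = {relabel \<sigma> x |\<sigma>. bij \<sigma>}"

definition networks :: "'n::card2 weights set set" where
  "networks = network_of ` orthant"

definition networks_topology :: "'n::card2 weights set topology" where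
  "networks_topology =
     topology (\<lambda>U. U \<subseteq> networks \<and> openin (top_of_set orthant) {x \<in> orthant. network_of x \<in> U})"

lemma openin_networks_topology:
  fixes U :: "'n::card2 weights set set"
  shows "openin networks_topology U \<longleftrightarrow>
     U \<subseteq> networks \<and> openin (top_of_set orthant) {x \<in> orthant. network_of x \<in> U}"
proof -
  have int: "{x \<in> orthant. network_of x \<in> S \<inter> T} =
      {x \<in> orthant. network_of x \<in> S} \<inter> {x \<in> orthant. network_of x \<in> T}" for S T :: "'n weights set set"
    by auto
  have un: "{x \<in> orthant. network_of x \<in> \<Union>\<K>} = (\<Union>S\<in>\<K>. {x \<in> orthant. network_of x \<in> S})"
    for \<K> :: "'n weights set set set"
    by auto
  have "istopology (\<lambda>U :: 'n weights set set.
      U \<subseteq> networks \<and> openin (top_of_set orthant) {x \<in> orthant. network_of x \<in> U})"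
    unfolding istopology_def int un by (auto intro!: openin_Int openin_Union)
  then show ?thesis
    by (simp add: networks_topology_def topology_inverse')
qed

lemma topspace_networks_topology:
  "topspace networks_topology = (networks :: 'n::card2 weights set set)"
proof -
  have "{x \<in> orthant. network_of x \<in> (networks :: 'n weights set set)} = orthant"
    by (auto simp: networks_def)
  then have "openin networks_topology (networks :: 'n weights set set)"
    by (simp add: openin_networks_topology)
  then show ?thesis
    by (meson openin_networks_topology openin_subset openin_topspace subset_antisym)
qed

lemma quotient_map_network_of: "quotient_map (top_of_set orthant) networks_topology network_of"
  by (auto simp: quotient_map_def topspace_networks_topology openin_networks_topology networks_def)

definition procrustes_dist :: "'n::card2 weights set \<Rightarrow> 'n weights set \<Rightarrow> real" where
  "procrustes_dist X Y = Min {dist x y |x y. x \<in> X \<and> y \<in> Y}"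

lemma procrustes_dist_network_of:
  "procrustes_dist (network_of x) (network_of y) =
     Min {dist (relabel \<sigma>\<^sub>1 x) (relabel \<sigma>\<^sub>2 y) |\<sigma>\<^sub>1 \<sigma>\<^sub>2. bij \<sigma>\<^sub>1 \<and> bij \<sigma>\<^sub>2}"
  unfolding procrustes_dist_def network_of_def by (rule arg_cong[where f = Min]) (safe; blast)


section \<open>Distinct vectors and their cones\<close>

definition distinct_vec :: "'n::card2 weights \<Rightarrow> bool" where
  "distinct_vec w \<longleftrightarrow> w \<in> orthant \<and> (\<forall>\<sigma>. bij \<sigma> \<and> \<sigma> \<noteq> id \<longrightarrow> relabel \<sigma> w \<noteq> w)"

text \<open>Only used for nonzero vectors.\<close>

definition angle :: "'a::real_inner \<Rightarrow> 'a \<Rightarrow> real" where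
  "angle x y = arccos (x \<bullet> y / (norm x * norm y))"

definition min_angle :: "'n::card2 weights \<Rightarrow> real" where
  "min_angle w = Min {angle w (relabel \<sigma> w) |\<sigma>. bij \<sigma> \<and> \<sigma> \<noteq> id}"

lemma min_angle_set:
  fixes w :: "'n::card2 weights"
  shows "finite {angle w (relabel \<sigma> w) |\<sigma>. bij \<sigma> \<and> \<sigma> \<noteq> id}"
    and "{angle w (relabel \<sigma> w) |\<sigma>. bij \<sigma> \<and> \<sigma> \<noteq> id} \<noteq> {}"
proof -
  show "finite {angle w (relabel \<sigma> w) |\<sigma>. bij \<sigma> \<and> \<sigma> \<noteq> id}"
    by simp
  obtain i j :: 'n where "i \<noteq> j"
    using two_le_card[where 'a = 'n] by (metis card_2_iff' obtain_subset_with_card_n)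
  then have "bij (Transposition.transpose i j)" "Transposition.transpose i j \<noteq> id"
    by (auto simp: fun_eq_iff Transposition.transpose_def)
  then show "{angle w (relabel \<sigma> w) |\<sigma>. bij \<sigma> \<and> \<sigma> \<noteq> id} \<noteq> {}"
    by blast
qed

definition cone_about :: "'n::card2 weights \<Rightarrow> real \<Rightarrow> 'n weights set" where
  "cone_about w c = {u \<in> orthant. u = 0 \<or> angle u w \<le> c}"

lemma distinct_vec_nonzero:
  assumes "distinct_vec w"
  shows "w \<noteq> 0"
proof
  assume "w = 0"
  then have "relabel \<sigma> w = w" for \<sigma>
    by (simp add: relabel_def vec_eq_iff)
  then have "{angle w (relabel \<sigma> w) |\<sigma>. bij \<sigma> \<and> \<sigma> \<noteq> id} = {}"
    using assms by (auto simp: distinct_vec_def)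
  then show False
    using min_angle_set(2) by blast
qed


section \<open>Frechet means\<close>

text \<open>The Frechet function is taken with values in \<open>[0, \<infinity>]\<close>, so that no integrability is
  presupposed.\<close>

definition frechet_function :: "('a \<Rightarrow> 'a \<Rightarrow> real) \<Rightarrow> 'a measure \<Rightarrow> 'a \<Rightarrow> ennreal" where
  "frechet_function \<rho> P p = (\<integral>\<^sup>+z. ennreal ((\<rho> p z)\<^sup>2) \<partial>P)"

definition is_frechet_mean :: "'a set \<Rightarrow> ('a \<Rightarrow> 'a \<Rightarrow> real) \<Rightarrow> 'a measure \<Rightarrow> 'a \<Rightarrow> bool" where
  "is_frechet_mean M \<rho> P p \<longleftrightarrow>
     p \<in> M \<and> (\<forall>p'\<in>M. frechet_function \<rho> P p \<le> frechet_function \<rho> P p')"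

definition center_of_mass ::
    "'a::{real_normed_vector, second_countable_topology} set \<Rightarrow> 'a measure \<Rightarrow> 'a" where
  "center_of_mass K Q = (LINT y:K|Q. y)"

definition networks_borel :: "'n::card2 weights set measure" where
  "networks_borel = sigma networks {U. openin networks_topology U}"

lemma space_networks_borel: "space networks_borel = networks"
  unfolding networks_borel_def by (rule space_measure_of) (auto simp: openin_networks_topology)

lemma measurable_network_of:
  "(network_of :: 'n::card2 weights \<Rightarrow> _) \<in> restrict_space borel orthant \<rightarrow>\<^sub>M networks_borel"
  unfolding networks_borel_def
proof (rule measurable_measure_of)
  show "{U. openin networks_topology U} \<subseteq> Pow (networks :: 'n weights set set)"
    by (auto simp: openin_networks_topology)
  show "(network_of :: 'n weights \<Rightarrow> _) \<in> space (restrict_space borel orthant) \<rightarrow> networks"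
    by (auto simp: space_restrict_space networks_def)
next
  fix U :: "'n weights set set"
  assume "U \<in> {U. openin networks_topology U}"
  then have "openin (top_of_set orthant) {x \<in> orthant. network_of x \<in> U}"
    by (simp add: openin_networks_topology)
  then obtain T where T: "open T" "{x \<in> orthant. network_of x \<in> U} = orthant \<inter> T"
    by (auto simp: openin_open)
  have "network_of -` U \<inter> space (restrict_space borel orthant) = orthant \<inter> T"
    using T(2) by (auto simp: space_restrict_space)
  then show "network_of -` U \<inter> space (restrict_space borel orthant) \<in> sets (restrict_space borel orthant)"
    using T(1) by (auto simp: sets_restrict_space)
qed

end

theory Submission
  imports Defs
begin

text \<open>The Frechet function at \<open>q(\<mu>)\<close> is at most the Euclidean one at \<open>\<mu>\<close>, so it suffices to find for
  every \<open>p\<close> a vector \<open>p'\<close>, possibly outside the orthant, with \<open>dist p' z \<le> d\<^sub>P([p],[z])\<close> for all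
  \<open>z\<close> in the cone; then \<open>\<mu>\<close> beats \<open>p'\<close> beats \<open>[p]\<close>.  Suppose the orbit element of \<open>p\<close> nearest in angle
  to the axis makes the angle \<open>t\<close> with it, and let \<open>b\<close> be the minimal angle of the axis.  If
  \<open>t \<le> b/4\<close>, that element itself works; if \<open>t \<ge> b/2\<close>, a multiple of the axis does; otherwise
  reflect the element in the hyperplane that touches the cone of angle \<open>b/4\<close>, which puts it at angle
  \<open>b/2 - t\<close>.

  For \<open>p'\<close> not in the orbit, uniqueness needs strict inequalities, which can fail on the boundary of
  the cone.  They are recovered by projecting along the all-ones vector, which is fixed by every
  relabelling: the projected minimal angle \<open>b\<close> exceeds \<open>a\<close>, and the cone of angle \<open>a/4\<close> projects
  into the interior of the cone of angle \<open>b/4\<close>.\<close>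

section \<open>Angles\<close>

text \<open>Zero vectors are covered because division by zero gives 0; \<open>angle\<close> then
  takes the value pi/2.\<close>

lemma abs_inner_div_norm_le_1: "\<bar>x \<bullet> y / (norm x * norm y)\<bar> \<le> (1::real)" for x y :: "'a::real_inner"
  using Cauchy_Schwarz_ineq2[of x y] by (auto simp: divide_le_eq abs_mult)

lemma angle_nonneg: "0 \<le> angle x y"
  using abs_inner_div_norm_le_1[of x y] unfolding angle_def abs_le_iff by (intro arccos_lbound) auto

lemma angle_le_pi: "angle x y \<le> pi"
  using abs_inner_div_norm_le_1[of x y] unfolding angle_def abs_le_iff by (intro arccos_ubound) auto

lemma cos_angle: "cos (angle x y) = x \<bullet> y / (norm x * norm y)"
  using abs_inner_div_norm_le_1[of x y] by (simp add: angle_def cos_arccos_abs)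

lemma inner_eq_cos_angle: "x \<bullet> y = norm x * norm y * cos (angle x y)"
  by (simp add: cos_angle)

lemma angle_commute: "angle x y = angle y x"
  by (simp add: angle_def inner_commute mult.commute)

lemma angle_sgn: "angle (sgn x) y = angle x y"
  by (cases "x = 0") (simp_all add: angle_def sgn_div_norm norm_sgn divide_simps)

lemma angle_le_iff:
  assumes "x \<noteq> 0" "y \<noteq> 0" "0 \<le> c" "c \<le> pi"
  shows "angle x y \<le> c \<longleftrightarrow> norm x * norm y * cos c \<le> x \<bullet> y"
  using cos_mono_le_eq[of c "angle x y"] assms angle_nonneg[of x y] angle_le_pi[of x y]
  by (simp add: inner_eq_cos_angle)

text \<open>Cosine decreases on [0, pi]. This is how angle estimates become comparisons of inner
  products, and later of distances.\<close>

lemma angle_less_inner_less: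
  assumes "norm x = norm y" "x \<noteq> 0" "z \<noteq> 0" "angle x z < angle y z"
  shows "y \<bullet> z < x \<bullet> z"
  using cos_monotone_0_pi[OF angle_nonneg assms(4) angle_le_pi] assms(1-3)
  by (simp add: inner_eq_cos_angle[of y z] inner_eq_cos_angle[of x z] flip: assms(1))

text \<open>The components of \<open>x\<close> and \<open>z\<close> orthogonal to \<open>y\<close>
  have norms sin A and sin B, so Cauchy-Schwarz bounds their inner product below by - sin A sin B;
  adding cos A cos B gives cos (A + B).\<close>

lemma angle_triangle_unit:
  assumes "norm x = 1" "norm y = 1" "norm z = 1"
  shows "angle x z \<le> angle x y + angle y z"
proof (cases "angle x y + angle y z \<le> pi")
  case False
  then show ?thesis using angle_le_pi[of x z] by linarith
next
  case True
  let ?A = "angle x y" and ?B = "angle y z"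
  have n: "x \<bullet> x = 1" "y \<bullet> y = 1" "z \<bullet> z = 1"
    using assms by (simp_all add: dot_square_norm)
  have c: "x \<bullet> y = cos ?A" "y \<bullet> z = cos ?B"
    using assms by (simp_all add: inner_eq_cos_angle[of x y] inner_eq_cos_angle[of y z])
  have s: "0 \<le> sin ?A" "0 \<le> sin ?B"
    by (simp_all add: angle_nonneg angle_le_pi sin_ge_zero)
  let ?x = "x - cos ?A *\<^sub>R y" and ?z = "z - cos ?B *\<^sub>R y"
  have "(norm ?x)\<^sup>2 = (sin ?A)\<^sup>2" "(norm ?z)\<^sup>2 = (sin ?B)\<^sup>2"
    using n c unfolding power2_norm_eq_inner sin_squared_eq
    by (simp_all add: inner_diff inner_commute power2_eq_square)
  then have "norm ?x = sin ?A" "norm ?z = sin ?B"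
    using s by (simp_all add: power2_eq_iff_nonneg)
  then have "- (sin ?A * sin ?B) \<le> ?x \<bullet> ?z"
    using Cauchy_Schwarz_ineq2[of ?x ?z] by (simp add: abs_le_iff)
  also have "?x \<bullet> ?z = x \<bullet> z - cos ?A * cos ?B"
    using n c by (simp add: inner_diff inner_commute algebra_simps)
  finally have "cos (?A + ?B) \<le> x \<bullet> z"
    by (simp add: cos_add)
  moreover have "x \<noteq> 0" "z \<noteq> 0" using assms by auto
  ultimately show ?thesis
    using True assms by (simp add: angle_le_iff angle_nonneg add_nonneg_nonneg)
qed

lemma angle_triangle:
  assumes "x \<noteq> 0" "y \<noteq> 0" "z \<noteq> 0"
  shows "angle x z \<le> angle x y + angle y z"
  using angle_triangle_unit[of "sgn x" "sgn y" "sgn z"] assms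
  by (metis angle_sgn angle_commute norm_sgn)

section \<open>Vectors dominating an orbit on a cone\<close>

text \<open>The two vectors are mirror images in the hyperplane with normal sin c v - cos c n, which
  touches the cone of angle \<open>c\<close> about \<open>v\<close>. The open cone lies on the same
  side as the vector of angle \<open>b\<close>.\<close>

lemma inner_less_reflected:
  fixes v x z :: "'a::real_inner"
  assumes "norm n = 1" "v \<bullet> n = 0" "norm v = 1" "z \<noteq> 0"
    and "angle z v < c" "c \<le> pi / 2" "b = 2 * c - t" "c < t" "t < 2 * c"
  shows "(cos t *\<^sub>R v + sin t *\<^sub>R n) \<bullet> z < (cos b *\<^sub>R v + sin b *\<^sub>R n) \<bullet> z"
proof -
  let ?A = "angle z v"
  have zv: "v \<bullet> z = norm z * cos ?A"
    using assms(3) by (simp add: inner_eq_cos_angle[of v z] angle_commute)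
  \<comment> \<open>Bessel's inequality for the orthonormal pair \<open>v\<close>,
    \<open>n\<close>.\<close>
  have "(z \<bullet> v)\<^sup>2 + (z \<bullet> n)\<^sup>2 \<le> (norm z)\<^sup>2"
  proof -
    have vn: "v \<bullet> v = 1" "n \<bullet> n = 1" "n \<bullet> v = 0"
      using assms by (simp_all add: dot_square_norm inner_commute)
    have "0 \<le> (z - (z \<bullet> v) *\<^sub>R v - (z \<bullet> n) *\<^sub>R n) \<bullet> (z - (z \<bullet> v) *\<^sub>R v - (z \<bullet> n) *\<^sub>R n)"
      by simp
    also have "\<dots> = (norm z)\<^sup>2 - (z \<bullet> v)\<^sup>2 - (z \<bullet> n)\<^sup>2"
      using vn assms(2) unfolding power2_norm_eq_inner
      by (simp add: inner_diff inner_commute power2_eq_square)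
    finally show ?thesis by simp
  qed
  then have "(n \<bullet> z)\<^sup>2 \<le> (norm z * sin ?A)\<^sup>2"
    using zv by (simp add: inner_commute power_mult_distrib sin_squared_eq algebra_simps)
  then have nz: "n \<bullet> z \<le> norm z * sin ?A"
    by (rule power2_le_imp_le) (simp add: angle_nonneg angle_le_pi sin_ge_zero)
  \<comment> \<open>Half the angle between the two vectors, whose bisector makes the angle
    \<open>c\<close> with \<open>v\<close>.\<close>
  define d where "d = t - c"
  have d: "0 < sin d" unfolding d_def using assms by (intro sin_gt_zero) auto
  have tb: "t = c + d" "b = c - d" using assms by (auto simp: d_def)
  have "cos b - cos t = 2 * sin c * sin d" "sin t - sin b = 2 * cos c * sin d"
    unfolding tb cos_add cos_diff sin_add sin_diff by simp_all
  then have eq: "(cos b *\<^sub>R v + sin b *\<^sub>R n) \<bullet> z - (cos t *\<^sub>R v + sin t *\<^sub>R n) \<bullet> z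
      = 2 * sin d * (sin c * (v \<bullet> z) - cos c * (n \<bullet> z))"
    by (simp add: inner_add_left) algebra
  have "0 \<le> cos c" using assms angle_nonneg[of z v] by (intro cos_ge_zero) auto
  then have "cos c * (n \<bullet> z) \<le> cos c * (norm z * sin ?A)"
    using nz by (rule mult_left_mono[rotated])
  moreover have "0 < norm z * sin (c - ?A)"
    using assms angle_nonneg[of z v] by (intro mult_pos_pos sin_gt_zero) auto
  ultimately have "0 < sin c * (v \<bullet> z) - cos c * (n \<bullet> z)"
    unfolding zv sin_diff by (simp add: algebra_simps)
  then have "0 < 2 * sin d * (sin c * (v \<bullet> z) - cos c * (n \<bullet> z))"
    using d by simp
  then show ?thesis using eq by linarith
qed

text \<open>The group is abstracted away: \<open>x\<close> plays the orbit element closest in angle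
  to \<open>v\<close>, and \<open>y\<close> any other one, which enters only through its norm and
  two lower bounds on its angle to \<open>v\<close>. The last conclusion compares \<open>x'\<close>
  with \<open>x\<close> itself.\<close>

lemma exists_dominating_vector:
  fixes v x :: "'a::real_inner"
  assumes "v \<noteq> 0" "x \<noteq> 0" "0 < b" "b \<le> pi"
  obtains x' where "norm x' = norm x"
    "\<forall>y z. norm y = norm x \<and> angle x v \<le> angle y v \<and> b - angle x v \<le> angle y v \<and>
        z \<noteq> 0 \<and> angle z v < b / 4 \<longrightarrow> y \<bullet> z < x' \<bullet> z"
    "x' = x \<or> (\<forall>z. z \<noteq> 0 \<longrightarrow> angle z v < b / 4 \<longrightarrow> x \<bullet> z < x' \<bullet> z)"
proof -
  let ?t = "angle x v"
  have sep: "b - ?t - angle z v \<le> angle y z"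
    if "norm y = norm x" "b - ?t \<le> angle y v" "z \<noteq> 0" for y z
  proof -
    have "y \<noteq> 0" using that(1) assms(2) by auto
    then have "angle y v \<le> angle y z + angle z v"
      using angle_triangle[of y z v] assms that by simp
    then show ?thesis using that by linarith
  qed
  consider "?t \<le> b / 4" | "b / 4 < ?t" "?t < b / 2" | "b / 2 \<le> ?t" by linarith
  then show thesis
  proof cases
    \<comment> \<open>Here \<open>x' = x\<close>: angle x z is at most t + angle z v, which is below
      b - t - angle z v because t is at most b/4 and angle z v is smaller than b/4.\<close>
    case 1
    have "y \<bullet> z < x \<bullet> z" if y: "norm y = norm x" "?t \<le> angle y v" "b - ?t \<le> angle y v"
        "z \<noteq> 0" "angle z v < b / 4" for y z
    proof -
      have "angle x z \<le> ?t + angle z v"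
        using angle_triangle[of x v z] assms y by (simp add: angle_commute)
      then have "angle x z < angle y z"
        using sep[of y z] y 1 by linarith
      then show ?thesis
        using angle_less_inner_less[of x y z] y assms by simp
    qed
    then show thesis by (intro that[of x]) auto
  next
    case 3
    \<comment> \<open>The axis, rescaled to the norm of \<open>x\<close>. Vectors at angle at least
      b/2 from \<open>v\<close>, among them \<open>x\<close>, are more than b/4 away from
      \<open>z\<close>.\<close>
    let ?x = "norm x *\<^sub>R sgn v"
    have n: "norm ?x = norm x" "?x \<noteq> 0" using assms by (auto simp: norm_sgn sgn_zero_iff)
    have ang: "angle ?x z = angle z v" for z
      using assms by (simp add: angle_def norm_sgn sgn_div_norm inner_commute mult.commute divide_simps)
    have less: "y \<bullet> z < ?x \<bullet> z" if "norm y = norm x" "?t \<le> angle y v"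
        "z \<noteq> 0" "angle z v < b / 4" for y z
    proof -
      have "y \<noteq> 0" using that(1) assms(2) by auto
      then have "angle y v \<le> angle y z + angle z v"
        using angle_triangle[of y z v] assms that by simp
      then have "angle ?x z < angle y z"
        using that 3 ang by simp
      then show ?thesis
        using angle_less_inner_less[of ?x y z] that n by simp
    qed
    show thesis
      by (rule that[of ?x]) (use less n in auto)
  next
    case 2
    \<comment> \<open>This is 2 * (b/4) - t, as \<open>inner_less_reflected\<close> requires for
      \<open>c = b / 4\<close>.\<close>
    let ?b = "b / 2 - ?t"
    define u where "u = sgn v"
    \<comment> \<open>The part of \<open>sgn x\<close> orthogonal to \<open>u\<close>. Its norm sin
      t is positive since 0 < t < pi, so \<open>n\<close> completes \<open>u\<close> to an
      orthonormal frame of the plane of \<open>x\<close> and \<open>v\<close>.\<close>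
    define m where "m = sgn x - cos ?t *\<^sub>R u"
    define n where "n = m /\<^sub>R sin ?t"
    have u1: "norm u = 1" "u \<bullet> u = 1"
      using assms by (simp_all add: u_def norm_sgn dot_square_norm)
    have xu: "sgn x \<bullet> u = cos ?t" "sgn x \<bullet> sgn x = 1"
      using assms by (simp_all add: u_def norm_sgn dot_square_norm cos_angle sgn_div_norm
        divide_inverse)
    have s: "0 < sin ?t" using 2 assms by (intro sin_gt_zero) auto
    have "(norm m)\<^sup>2 = (sin ?t)\<^sup>2"
      using u1 xu unfolding power2_norm_eq_inner sin_squared_eq m_def
      by (simp add: inner_diff inner_commute power2_eq_square)
    then have "norm m = sin ?t" using s by (simp add: power2_eq_iff_nonneg)
    then have n1: "norm n = 1" using s by (simp add: n_def)
    have un: "u \<bullet> n = 0"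
      using u1 xu by (simp add: n_def m_def inner_diff inner_commute)
    have x: "x = norm x *\<^sub>R (cos ?t *\<^sub>R u + sin ?t *\<^sub>R n)"
      using s assms by (simp add: n_def m_def sgn_div_norm)
    let ?y = "cos ?b *\<^sub>R u + sin ?b *\<^sub>R n"
    let ?x = "norm x *\<^sub>R ?y"
    have yy: "?y \<bullet> ?y = 1"
    proof -
      have "n \<bullet> n = 1" using n1 by (simp add: dot_square_norm)
      then have "(c *\<^sub>R u + s *\<^sub>R n) \<bullet> (c *\<^sub>R u + s *\<^sub>R n) = c\<^sup>2 + s\<^sup>2" for c s
        using un u1(2) by (simp add: inner_add inner_commute power2_eq_square)
      then show ?thesis by simp
    qed
    then have y1: "norm ?y = 1" by (simp only: norm_eq_sqrt_inner real_sqrt_one)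
    then have nx: "norm ?x = norm x" by simp
    then have nx0: "?x \<noteq> 0" using assms by (metis norm_eq_zero)
    have yu: "?y \<bullet> u = cos ?b"
      using un u1 by (simp add: inner_add_left inner_commute[of n])
    have "angle ?x v = angle ?y u"
      using assms nx y1 by (simp add: angle_def u_def norm_sgn sgn_div_norm divide_simps)
    also have "\<dots> = ?b"
      using yu y1 u1 2 assms by (simp add: angle_def arccos_cos)
    finally have angx: "angle ?x v = ?b" .
    have "y \<bullet> z < ?x \<bullet> z" if y: "norm y = norm x" "?t \<le> angle y v" "b - ?t \<le> angle y v"
        "z \<noteq> 0" "angle z v < b / 4" for y z
    proof -
      \<comment> \<open>By \<open>sep\<close>, angle y z is at least b - t - angle z v; this is
        larger, as b/2 exceeds twice angle z v.\<close>
      have "angle ?x z \<le> ?b + angle z v"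
        using angle_triangle[of ?x v z] assms y nx0 angx by (simp add: angle_commute)
      then have "angle ?x z < angle y z"
        using sep[of y z] y by linarith
      then show ?thesis
        using angle_less_inner_less[of ?x y z] y nx nx0 by simp
    qed
    moreover have "x \<bullet> z < ?x \<bullet> z" if "z \<noteq> 0" "angle z v < b / 4" for z
    proof -
      have "angle z u < b / 4" using that by (simp add: u_def angle_sgn angle_commute[of z])
      then have "(cos ?t *\<^sub>R u + sin ?t *\<^sub>R n) \<bullet> z < ?y \<bullet> z"
        using inner_less_reflected[of n u z "b/4" ?b ?t] n1 un u1 that 2 assms by simp
      then show ?thesis
        using assms by (subst x) (simp add: inner_scaleR_left)
    qed
    ultimately show thesis
      using nx by (intro that[of ?x]) blast+
  qed
qed

section \<open>Projection along a unit vector\<close>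

definition perp :: "'a::real_inner \<Rightarrow> 'a \<Rightarrow> 'a" where
  "perp e x = x - (x \<bullet> e) *\<^sub>R e"

lemma perp_decomp: "x = perp e x + (x \<bullet> e) *\<^sub>R e"
  by (simp add: perp_def)

lemma inner_perp_perp:
  assumes "norm e = 1"
  shows "perp e x \<bullet> perp e y = x \<bullet> y - (x \<bullet> e) * (y \<bullet> e)"
proof -
  have "e \<bullet> e = 1" using assms by (simp add: dot_square_norm)
  then show ?thesis by (simp add: perp_def inner_diff inner_commute)
qed

lemma inner_perp_left: "perp e x \<bullet> y = x \<bullet> y - (x \<bullet> e) * (y \<bullet> e)"
  by (simp add: perp_def inner_diff_left inner_commute[of e])

lemma norm_perp:
  assumes "norm e = 1"
  shows "(norm (perp e x))\<^sup>2 = (norm x)\<^sup>2 - (x \<bullet> e)\<^sup>2"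
  unfolding power2_norm_eq_inner inner_perp_perp[OF assms] by (simp add: power2_eq_square)

lemma perp_perp:
  assumes "norm e = 1"
  shows "perp e (perp e x) = perp e x"
proof -
  have "e \<bullet> e = 1" using assms by (simp add: dot_square_norm)
  then have "perp e x \<bullet> e = 0" by (simp add: inner_perp_left)
  then show ?thesis by (simp add: perp_def)
qed

text \<open>Since \<open>w\<close> and \<open>w'\<close> have equal components along
  \<open>e\<close>, their chord survives the projection while their norm shrinks, so the angle
  between them grows beyond \<open>a\<close>. For \<open>z\<close>, Cauchy-Schwarz bounds P sin c by
  W sin (a/4); double angle formulas relate this to the chord and give sin c < sin (b/4).\<close>

lemma angle_perp_less:
  fixes e w w' z :: "'a::real_inner"
  assumes e: "norm e = 1" and we: "w \<bullet> e \<noteq> 0" "w' \<bullet> e = w \<bullet> e" "norm w' = norm w"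
    and a: "0 < a" "a \<le> angle w w'"
    and z: "z \<noteq> 0" "angle z w \<le> a / 4"
  shows "perp e z \<noteq> 0" "angle (perp e z) (perp e w) < angle (perp e w) (perp e w') / 4"
proof -
  define W P b c where "W = norm w" "P = norm (perp e w)" "b = angle (perp e w) (perp e w')"
    "c = angle (perp e z) (perp e w)"
  note defs = this
  have b: "0 \<le> b" "b \<le> pi" and c: "0 \<le> c" "c \<le> pi"
    by (simp_all add: defs angle_nonneg angle_le_pi)
  have api: "a \<le> pi" using a angle_le_pi[of w w'] by linarith
  have W: "0 < W" using we by (auto simp: defs)
  have P0: "0 \<le> P" by (simp add: defs)
  have P2: "P\<^sup>2 = W\<^sup>2 - (w \<bullet> e)\<^sup>2" by (simp add: defs norm_perp[OF e])
  have "P\<^sup>2 < W\<^sup>2" using P2 we by simp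
  then have PW: "P < W" by (rule power2_less_imp_less) (use W in simp)
  have "(norm (perp e w'))\<^sup>2 = (norm (perp e w))\<^sup>2"
    by (simp add: norm_perp[OF e] we)
  then have P': "norm (perp e w') = P" by (simp add: defs)
  have sa: "0 < sin (a/2)" using a api by (intro sin_gt_zero) auto
  have ca: "0 < cos (a/4)" using a api by (intro cos_gt_zero_pi) auto
  have sa4: "0 < sin (a/4)" using a api by (intro sin_gt_zero) auto
  \<comment> \<open>half the chord from \<open>w\<close> to \<open>w'\<close>, which is orthogonal to \<open>e\<close>\<close>
  have chord: "W * sin (a/2) \<le> P * sin (b/2)"
  proof (rule power2_le_imp_le)
    have "cos (angle w w') \<le> cos a"
      using a by (intro cos_monotone_0_pi_le angle_le_pi) auto
    then have "w \<bullet> w' \<le> W\<^sup>2 * cos a"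
      using W we by (simp add: inner_eq_cos_angle[of w w'] defs power2_eq_square)
    moreover have "w \<bullet> w' = (w \<bullet> e)\<^sup>2 + P\<^sup>2 * cos b"
      using inner_perp_perp[OF e, of w w'] P' we
      by (simp add: inner_eq_cos_angle[of "perp e w" "perp e w'"] defs power2_eq_square)
    ultimately have "W\<^sup>2 * (1 - cos a) \<le> P\<^sup>2 * (1 - cos b)"
      using P2 unfolding right_diff_distrib by linarith
    then show "(W * sin (a/2))\<^sup>2 \<le> (P * sin (b/2))\<^sup>2"
      using cos_double_sin[of "a/2"] cos_double_sin[of "b/2"] by (simp add: power_mult_distrib)
    show "0 \<le> P * sin (b/2)" using P0 b by (simp add: sin_ge_zero)
  qed
  \<comment> \<open>The chord bound rules out that \<open>w\<close> is parallel to
    \<open>e\<close>.\<close>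
  have "0 < P * sin (b/2)" using chord W sa by (smt (verit) mult_pos_pos)
  then have P: "0 < P" and sb: "0 < sin (b/2)"
    using P0 b by (auto simp: zero_less_mult_iff)
  have "W * sin (a/2) < W * sin (b/2)"
    using chord PW sb by (smt (verit) mult_strict_right_mono)
  then have sab: "sin (a/2) < sin (b/2)" using W by simp
  have ab: "a < b"
  proof (rule ccontr)
    assume "\<not> a < b"
    then have "sin (b/2) \<le> sin (a/2)" using api b by (intro sin_monotone_2pi_le) auto
    then show False using sab by simp
  qed
  have zw: "norm z * W * cos (a/4) \<le> z \<bullet> w"
    using angle_le_iff[of z w "a/4"] z W a api by (auto simp: defs)
  have zwp: "z \<bullet> w = (z \<bullet> e) * (w \<bullet> e) + perp e z \<bullet> perp e w"
    by (simp add: inner_perp_perp[OF e])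
  \<comment> \<open>Otherwise the components along \<open>e\<close> alone would carry the angle
    bound on \<open>z\<close>, forcing P <= W sin (a/4) < W sin (a/2) <= P.\<close>
  have pos: "0 < perp e z \<bullet> perp e w"
  proof (rule ccontr)
    assume "\<not> ?thesis"
    then have "norm z * W * cos (a/4) \<le> (z \<bullet> e) * (w \<bullet> e)" using zw zwp by linarith
    also have "\<dots> \<le> \<bar>z \<bullet> e\<bar> * \<bar>w \<bullet> e\<bar>" by (metis abs_ge_self abs_mult)
    also have "\<dots> \<le> norm z * \<bar>w \<bullet> e\<bar>"
      using Cauchy_Schwarz_ineq2[of z e] e by (intro mult_right_mono) auto
    finally have "W * cos (a/4) \<le> \<bar>w \<bullet> e\<bar>" using z by (simp add: mult.assoc)
    then have "(W * cos (a/4))\<^sup>2 \<le> (w \<bullet> e)\<^sup>2"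
      using W ca by (metis abs_le_square_iff abs_of_pos mult_pos_pos)
    then have "P\<^sup>2 \<le> (W * sin (a/4))\<^sup>2"
      using P2 by (simp add: power_mult_distrib cos_squared_eq algebra_simps)
    then have "P \<le> W * sin (a/4)"
      by (rule power2_le_imp_le) (use W sa4 in auto)
    also have "\<dots> < W * sin (a/2)"
      using W a api by (intro mult_strict_left_mono sin_monotone_2pi) auto
    also have "\<dots> \<le> P * 1"
      using chord P0 by (meson order_trans mult_left_mono sin_le_one)
    finally show False by simp
  qed
  show "perp e z \<noteq> 0" using pos by auto
  define Z where "Z = norm (perp e z)"
  have Z2: "Z\<^sup>2 = (norm z)\<^sup>2 - (z \<bullet> e)\<^sup>2" by (simp add: Z_def norm_perp[OF e])
  have pzw: "perp e z \<bullet> perp e w = Z * (P * cos c)"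
    by (simp add: inner_eq_cos_angle[of "perp e z"] defs Z_def)
  \<comment> \<open>Cauchy-Schwarz in the plane for the pairs (z . e, Z) and (w . e, P cos c), where
    P and Z are the projected norms.\<close>
  have "(norm z)\<^sup>2 * (W * cos (a/4))\<^sup>2 \<le> (norm z)\<^sup>2 * (W\<^sup>2 - (P * sin c)\<^sup>2)"
  proof -
    have "(norm z * W * cos (a/4))\<^sup>2 \<le> ((z \<bullet> e) * (w \<bullet> e) + Z * (P * cos c))\<^sup>2"
      using zw W ca unfolding zwp pzw by (intro power_mono) auto
    also have "\<dots> \<le> ((z \<bullet> e)\<^sup>2 + Z\<^sup>2) * ((w \<bullet> e)\<^sup>2 + (P * cos c)\<^sup>2)"
    proof -
      have "((z \<bullet> e)\<^sup>2 + Z\<^sup>2) * ((w \<bullet> e)\<^sup>2 + (P * cos c)\<^sup>2)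
          - ((z \<bullet> e) * (w \<bullet> e) + Z * (P * cos c))\<^sup>2 = ((z \<bullet> e) * (P * cos c) - Z * (w \<bullet> e))\<^sup>2"
        by (simp add: power2_eq_square algebra_simps)
      then show ?thesis by (smt (verit) zero_le_power2)
    qed
    also have "\<dots> = (norm z)\<^sup>2 * (W\<^sup>2 - (P * sin c)\<^sup>2)"
      using Z2 P2 by (simp add: power_mult_distrib cos_squared_eq algebra_simps)
    finally show ?thesis by (simp add: power_mult_distrib mult.assoc)
  qed
  then have "(P * sin c)\<^sup>2 \<le> (W * sin (a/4))\<^sup>2"
    using z by (simp add: power_mult_distrib cos_squared_eq algebra_simps)
  then have "P * sin c \<le> W * sin (a/4)"
    by (rule power2_le_imp_le) (use W sa4 in auto)
  \<comment> \<open>The factor 2 cos (a/4) turns the right side into W sin (a/2), where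
    \<open>chord\<close> applies.\<close>
  then have "P * sin c * (2 * cos (a/4)) \<le> W * sin (a/4) * (2 * cos (a/4))"
    using ca by (intro mult_right_mono) auto
  also have "\<dots> = W * sin (a/2)" using sin_double[of "a/4"] by simp
  also note chord
  also have "P * sin (b/2) = P * (sin (b/4) * (2 * cos (b/4)))" using sin_double[of "b/4"] by simp
  finally have "P * (sin c * cos (a/4)) \<le> P * (sin (b/4) * cos (b/4))"
    by (simp add: algebra_simps)
  then have "sin c * cos (a/4) \<le> sin (b/4) * cos (b/4)" using P by simp
  also have "\<dots> < sin (b/4) * cos (a/4)"
    using ab a b by (intro mult_strict_left_mono cos_monotone_0_pi sin_gt_zero) auto
  finally have sc: "sin c < sin (b/4)" using ca by simp
  \<comment> \<open>Sine is monotone only up to pi/2, so \<open>pos\<close> is needed to pass from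
    sines back to angles.\<close>
  have "0 < Z * (P * cos c)" using pos pzw by simp
  then have "0 < cos c"
    using P P0 by (auto simp: zero_less_mult_iff Z_def)
  then have c2: "c \<le> pi / 2"
    using cos_monotone_0_pi_le[of "pi/2" c] c by fastforce
  have "c < b / 4"
  proof (rule ccontr)
    assume "\<not> c < b / 4"
    then have "sin (b/4) \<le> sin c" using c2 b by (intro sin_monotone_2pi_le) auto
    then show False using sc by simp
  qed
  then show "angle (perp e z) (perp e w) < angle (perp e w) (perp e w') / 4"
    by (simp add: defs)
qed

section \<open>Relabelling and the Procrustean distance\<close>

lemma bij_map_edge:
  assumes "bij f"
  shows "bij (map_edge f)"
proof -
  have "inj (map_edge f)"
    using assms
    by (auto intro!: injI simp: endpoints_map_edge bij_def inj_image_eq_iff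
        simp flip: endpoints_inject)
  then show ?thesis by (simp add: bij_def finite_UNIV_inj_surj)
qed

lemma linear_relabel: "linear (relabel \<sigma>)"
  by (rule linearI) (simp_all add: relabel_def vec_eq_iff)

lemma inner_relabel:
  assumes "bij \<sigma>"
  shows "relabel \<sigma> x \<bullet> relabel \<sigma> y = x \<bullet> y"
  unfolding inner_vec_def relabel_def vec_lambda_beta
  using sum.reindex_bij_betw[OF bij_map_edge[OF bij_imp_bij_inv[OF assms]], of "\<lambda>e. x $ e \<bullet> y $ e"] .

lemma norm_relabel: "bij \<sigma> \<Longrightarrow> norm (relabel \<sigma> x) = norm x"
  by (simp add: norm_eq_sqrt_inner inner_relabel)

lemma dist_relabel: "bij \<sigma> \<Longrightarrow> dist (relabel \<sigma> x) (relabel \<sigma> y) = dist x y"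
  by (simp add: dist_norm norm_relabel flip: linear_diff[OF linear_relabel])

lemma angle_relabel: "bij \<sigma> \<Longrightarrow> angle (relabel \<sigma> x) (relabel \<sigma> y) = angle x y"
  by (simp add: angle_def inner_relabel norm_relabel)

lemma relabel_inv: "bij \<sigma> \<Longrightarrow> relabel (inv \<sigma>) (relabel \<sigma> x) = x"
  by (metis bij_def bij_imp_bij_inv inv_o_cancel relabel_comp relabel_id)

text \<open>\<open>1\<close> is the all-ones weight vector; its unit multiple is the direction along
  which vectors get projected.\<close>

lemma relabel_sgn_1: "relabel \<sigma> (sgn 1) = sgn 1"
  by (simp add: sgn_div_norm linear_scale[OF linear_relabel]) (simp add: relabel_def vec_eq_iff)

lemma perp_relabel:
  assumes "bij \<sigma>"
  shows "perp (sgn 1) (relabel \<sigma> x) = relabel \<sigma> (perp (sgn 1) x)"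
proof -
  have "relabel \<sigma> x \<bullet> sgn 1 = x \<bullet> sgn 1"
    using inner_relabel[OF assms, of x "sgn 1"] by (simp add: relabel_sgn_1)
  then show ?thesis
    by (simp add: perp_def linear_diff[OF linear_relabel] linear_scale[OF linear_relabel]
        relabel_sgn_1)
qed

text \<open>Angle 0 is the equality case of Cauchy-Schwarz, which for vectors of equal norm means
  equal vectors, against distinctness.\<close>

lemma min_angle_pos:
  assumes "distinct_vec w"
  shows "0 < min_angle w"
proof -
  have "0 < angle w (relabel \<sigma> w)" if "bij \<sigma>" "\<sigma> \<noteq> id" for \<sigma>
  proof (rule ccontr)
    assume "\<not> ?thesis"
    then have "angle w (relabel \<sigma> w) = 0" using angle_nonneg[of w "relabel \<sigma> w"] by linarith
    then have "w \<bullet> relabel \<sigma> w = norm w * norm (relabel \<sigma> w)"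
      by (simp add: inner_eq_cos_angle)
    then have "norm w *\<^sub>R relabel \<sigma> w = norm w *\<^sub>R w"
      unfolding norm_cauchy_schwarz_eq using that by (simp add: norm_relabel)
    then have "relabel \<sigma> w = w"
      using distinct_vec_nonzero[OF assms] by simp
    then show False using assms that by (simp add: distinct_vec_def)
  qed
  then show ?thesis
    using min_angle_set[of w] by (auto simp: min_angle_def)
qed

text \<open>Projection along \<open>e\<close> sends the cone without its vertex into an open cone of
  angle \<open>b / 4\<close>, where \<open>exists_dominating_vector\<close> is strict. The component
  along \<open>e\<close> is constant on the orbit of \<open>p\<close> and is put back
  afterwards.\<close>

lemma exists_dominating_weights:
  fixes w p :: "'n::card2 weights"
  assumes w: "distinct_vec w"
  obtains p' where "norm p' \<le> norm p"
    "\<forall>\<sigma>. bij \<sigma> \<longrightarrow> (\<forall>z\<in>cone_about w (min_angle w / 4). relabel \<sigma> p \<bullet> z \<le> p' \<bullet> z)"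
    "p' \<in> network_of p \<or>
      (\<forall>\<sigma>. bij \<sigma> \<longrightarrow> (\<forall>z\<in>cone_about w (min_angle w / 4) - {0}. relabel \<sigma> p \<bullet> z < p' \<bullet> z))"
proof -
  define e where "e = (sgn 1 :: 'n weights)"
  define C where "C = cone_about w (min_angle w / 4)"
  have e1: "norm e = 1" by (simp add: e_def norm_sgn vec_eq_iff)
  have pr: "perp e (relabel \<sigma> x) = relabel \<sigma> (perp e x)" if "bij \<sigma>" for \<sigma> x
    using perp_relabel[OF that] by (simp add: e_def)
  have er: "relabel \<sigma> x \<bullet> e = x \<bullet> e" if "bij \<sigma>" for \<sigma> x
    using inner_relabel[OF that, of x "sgn 1"] by (simp add: e_def relabel_sgn_1)
  define v where "v = perp e w"
  have w0: "w \<noteq> 0" by (rule distinct_vec_nonzero[OF w])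
  \<comment> \<open>The coordinates of \<open>w\<close> are nonnegative and not all zero, so their
    sum is nonzero.\<close>
  have we: "w \<bullet> e \<noteq> 0"
  proof -
    have "w \<bullet> 1 \<noteq> 0"
      using w w0 by (auto simp: inner_vec_def vec_eq_iff distinct_vec_def orthant_def
          sum_nonneg_eq_0_iff)
    then show ?thesis by (simp add: e_def sgn_div_norm vec_eq_iff)
  qed
  define S where "S = {angle v (relabel \<sigma> v) |\<sigma>. bij \<sigma> \<and> \<sigma> \<noteq> id}"
  define b where "b = Min S"
  have S: "finite S" "S \<noteq> {}"
    using min_angle_set[of v] by (simp_all add: S_def)
  have bS: "b \<le> angle v (relabel \<sigma> v)" if "bij \<sigma>" "\<sigma> \<noteq> id" for \<sigma>
    unfolding b_def using S(1) that by (intro Min_le) (auto simp: S_def)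
  have "b \<in> S" using S by (simp add: b_def)
  \<comment> \<open>The minimiser is kept so that \<open>angle_perp_less\<close>, applied to
    \<open>relabel \<kappa> w\<close>, yields the bound \<open>b / 4\<close> itself.\<close>
  then obtain \<kappa> where \<kappa>: "bij \<kappa>" "\<kappa> \<noteq> id" "b = angle v (relabel \<kappa> v)"
    by (auto simp: S_def)
  have "min_angle w \<le> angle w (relabel \<kappa> w)"
    unfolding min_angle_def using min_angle_set(1) \<kappa> by (intro Min_le) auto
  then have cone: "perp e z \<noteq> 0" "angle (perp e z) v < b / 4" if "z \<in> C - {0}" for z
    using angle_perp_less[OF e1 we, of "relabel \<kappa> w" "min_angle w" z] that min_angle_pos[OF w] \<kappa>
    by (auto simp: C_def cone_about_def er norm_relabel pr v_def)
  have "angle w w = 0"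
    using w0 by (simp add: angle_def dot_square_norm power2_eq_square)
  \<comment> \<open>Applying \<open>cone\<close> to the axis gives \<open>v \<noteq> 0\<close>, and
    also \<open>0 < b\<close> because angles are nonnegative.\<close>
  then have "w \<in> C - {0}"
    using w w0 min_angle_pos[OF w] by (simp add: C_def cone_about_def distinct_vec_def)
  then have v0: "v \<noteq> 0" and b0: "0 < b"
    using cone[of w] angle_nonneg[of v v] by (simp_all add: v_def)
  have bpi: "b \<le> pi" using \<kappa>(3) angle_le_pi by simp
  have split: "x \<bullet> z = perp e x \<bullet> perp e z + (x \<bullet> e) * (z \<bullet> e)" for x z
    by (simp add: inner_perp_perp[OF e1])
  show thesis
  proof (cases "perp e p = 0")
    \<comment> \<open>Then \<open>p\<close> is a multiple of \<open>e\<close>, hence fixed by every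
      relabelling, and serves as its own \<open>p'\<close>.\<close>
    case True
    then have "perp e (relabel \<sigma> p) = 0" if "bij \<sigma>" for \<sigma>
      using that by (simp add: pr linear_0[OF linear_relabel])
    then have "relabel \<sigma> p = p" if "bij \<sigma>" for \<sigma>
      using that True perp_decomp[of "relabel \<sigma> p" e] perp_decomp[of p e] by (simp add: er)
    then show thesis
      by (intro that[of p]) (auto simp: network_of_def intro!: exI[of _ id])
  next
    case False
    let ?A = "\<lambda>\<sigma>. angle (relabel \<sigma> (perp e p)) v"
    have "finite {\<sigma> :: 'n \<Rightarrow> 'n. bij \<sigma>}" "{\<sigma> :: 'n \<Rightarrow> 'n. bij \<sigma>} \<noteq> {}"
      using bij_id by auto
    then obtain \<tau> where \<tau>: "bij \<tau>" and min: "\<And>\<sigma>. bij \<sigma> \<Longrightarrow> ?A \<tau> \<le> ?A \<sigma>"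
      using ex_is_arg_min_if_finite[of "{\<sigma> :: 'n \<Rightarrow> 'n. bij \<sigma>}" ?A]
      by (auto simp: is_arg_min_linorder)
    define x where "x = relabel \<tau> (perp e p)"
    have nx: "norm (relabel \<sigma> (perp e p)) = norm x" if "bij \<sigma>" for \<sigma>
      using that \<tau> by (simp add: x_def norm_relabel)
    have x0: "x \<noteq> 0" using False \<tau> norm_relabel[of \<tau>] by (metis norm_eq_zero x_def)
    \<comment> \<open>Triangle inequality through \<open>relabel \<rho> x\<close>: it is
      \<open>angle x v\<close> away from \<open>relabel \<rho> v\<close>, which is at least
      \<open>b\<close> away from \<open>v\<close>.\<close>
    have far: "b - angle x v \<le> ?A \<sigma>" if "bij \<sigma>" "\<sigma> \<noteq> \<tau>" for \<sigma>
    proof -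
      define \<rho> where "\<rho> = \<sigma> \<circ> inv \<tau>"
      have \<rho>: "bij \<rho>" "\<sigma> = \<rho> \<circ> \<tau>"
        using that \<tau> by (auto simp: \<rho>_def bij_comp bij_imp_bij_inv o_assoc[symmetric] bij_is_inj)
      then have "\<rho> \<noteq> id" using that by auto
      have eq: "relabel \<sigma> (perp e p) = relabel \<rho> x"
        using \<rho> \<tau> relabel_comp by (simp add: x_def)
      have "relabel \<rho> x \<noteq> 0" "relabel \<rho> v \<noteq> 0"
        using x0 v0 \<rho> norm_relabel by (metis norm_eq_zero)+
      then have "angle v (relabel \<rho> v) \<le> angle v (relabel \<rho> x) + angle (relabel \<rho> x) (relabel \<rho> v)"
        using v0 by (intro angle_triangle)
      then show ?thesis
        using bS[of \<rho>] \<rho> \<open>\<rho> \<noteq> id\<close> eq by (simp add: angle_relabel angle_commute)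
    qed
    obtain x' where x': "norm x' = norm x"
      "\<forall>y z. norm y = norm x \<and> angle x v \<le> angle y v \<and> b - angle x v \<le> angle y v \<and>
        z \<noteq> 0 \<and> angle z v < b / 4 \<longrightarrow> y \<bullet> z < x' \<bullet> z"
      "x' = x \<or> (\<forall>z. z \<noteq> 0 \<longrightarrow> angle z v < b / 4 \<longrightarrow> x \<bullet> z < x' \<bullet> z)"
      by (rule exists_dominating_vector[OF v0 x0 b0 bpi])
    \<comment> \<open>Any component of \<open>x'\<close> along \<open>e\<close> is replaced by that
      of \<open>p\<close>; dropping it cannot increase the norm.\<close>
    define p' where "p' = perp e x' + (p \<bullet> e) *\<^sub>R e"
    have ee: "e \<bullet> e = 1" using e1 by (simp add: dot_square_norm)
    have pxe: "perp e x' \<bullet> e = 0" by (simp add: inner_perp_left ee)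
    have p'e: "p' \<bullet> e = p \<bullet> e" by (simp add: p'_def inner_add_left pxe ee)
    have pp': "perp e p' = perp e x'"
      using perp_decomp[of p' e] by (simp add: p'e) (simp add: p'_def)
    have p'z: "p' \<bullet> z = x' \<bullet> perp e z + (p \<bullet> e) * (z \<bullet> e)" for z
      using split[of p' z] p'e pp' e1
      by (metis inner_perp_left inner_perp_perp perp_perp inner_commute)
    have rz: "relabel \<sigma> p \<bullet> z = relabel \<sigma> (perp e p) \<bullet> perp e z + (p \<bullet> e) * (z \<bullet> e)"
      if "bij \<sigma>" for \<sigma> z
      using split[of "relabel \<sigma> p" z] that by (simp add: pr er)
    \<comment> \<open>\<open>far\<close> says nothing about the minimiser \<open>\<tau>\<close>,
      which is left to \<open>alt\<close>.\<close>
    have less: "relabel \<sigma> p \<bullet> z < p' \<bullet> z" if "bij \<sigma>" "\<sigma> \<noteq> \<tau>" "z \<in> C - {0}" for \<sigma> z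
      using x'(2)[rule_format, of "relabel \<sigma> (perp e p)" "perp e z"] nx[of \<sigma>] min[of \<sigma>] far[of \<sigma>] cone[of z] that
      by (simp add: p'z rz flip: x_def)
    have alt: "x' = x \<or> (\<forall>z\<in>C - {0}. relabel \<tau> p \<bullet> z < p' \<bullet> z)"
      using x'(3) cone \<tau> by (auto simp: p'z rz simp flip: x_def)
    have eq: "p' = relabel \<tau> p" if "x' = x"
    proof -
      have "perp e x' = perp e (relabel \<tau> p)"
        using that pr[OF \<tau>, of p] by (metis x_def perp_perp[OF e1])
      then show ?thesis
        using perp_decomp[of "relabel \<tau> p" e] \<tau> by (simp add: p'_def er)
    qed
    show thesis
    proof (rule that[of p'])
      have "(norm p')\<^sup>2 = (norm x')\<^sup>2 - (x' \<bullet> e)\<^sup>2 + (p \<bullet> e)\<^sup>2"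
        using norm_perp[OF e1, of p'] norm_perp[OF e1, of x'] by (simp add: p'e pp')
      also have "\<dots> \<le> (norm (perp e p))\<^sup>2 + (p \<bullet> e)\<^sup>2"
        using \<tau> by (simp add: x'(1) x_def norm_relabel)
      also have "\<dots> = (norm p)\<^sup>2" using norm_perp[OF e1, of p] by simp
      finally show "norm p' \<le> norm p" by (rule power2_le_imp_le) simp
    next
      have "relabel \<sigma> p \<bullet> z \<le> p' \<bullet> z" if "bij \<sigma>" "z \<in> C" for \<sigma> z
      proof (cases "z = 0")
        case False
        then have "x' = x \<or> relabel \<tau> p \<bullet> z < p' \<bullet> z" using alt that by blast
        then show ?thesis
          using less[of \<sigma> z] eq that False by (cases "\<sigma> = \<tau>") auto
      qed simp
      then show "\<forall>\<sigma>. bij \<sigma> \<longrightarrow> (\<forall>z\<in>cone_about w (min_angle w / 4). relabel \<sigma> p \<bullet> z \<le> p' \<bullet> z)"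
        by (simp add: C_def)
    next
      show "p' \<in> network_of p \<or>
        (\<forall>\<sigma>. bij \<sigma> \<longrightarrow> (\<forall>z\<in>cone_about w (min_angle w / 4) - {0}. relabel \<sigma> p \<bullet> z < p' \<bullet> z))"
        using alt eq less \<tau> unfolding C_def network_of_def by blast
    qed
  qed
qed

section \<open>Orbits, the Procrustean distance and measurability\<close>

lemma network_of_relabel:
  assumes "bij \<sigma>"
  shows "network_of (relabel \<sigma> x) = network_of x"
proof -
  have "relabel \<tau> (relabel \<sigma> x) \<in> network_of x" if "bij \<tau>" for \<tau>
    using that assms
    by (auto simp: network_of_def relabel_comp bij_comp intro!: exI[of _ "\<tau> \<circ> \<sigma>"])
  moreover have "relabel \<tau> x \<in> network_of (relabel \<sigma> x)" if "bij \<tau>" for \<tau>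
  proof -
    have "relabel \<tau> x = relabel (\<tau> \<circ> inv \<sigma>) (relabel \<sigma> x)"
      using that assms by (simp add: relabel_comp bij_imp_bij_inv relabel_inv)
    then show ?thesis
      using that assms
      by (auto simp: network_of_def bij_comp bij_imp_bij_inv intro!: exI[of _ "\<tau> \<circ> inv \<sigma>"])
  qed
  ultimately show ?thesis by (auto simp: network_of_def)
qed

lemma finite_network_dists:
  "finite {dist x y |x y. x \<in> network_of (p :: 'n::card2 weights) \<and> y \<in> network_of z}"
proof -
  have "finite (network_of q)" for q :: "'n weights" by (simp add: network_of_def)
  then have "finite ((\<lambda>(x, y). dist x y) ` (network_of p \<times> network_of z))" by blast
  moreover have "{dist x y |x y. x \<in> network_of p \<and> y \<in> network_of z}
      = (\<lambda>(x, y). dist x y) ` (network_of p \<times> network_of z)" by auto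
  ultimately show ?thesis by simp
qed

lemma self_in_network_of: "x \<in> network_of x"
  unfolding network_of_def using bij_id relabel_id by (metis (mono_tags, lifting) mem_Collect_eq)

lemma procrustes_dist_le:
  assumes "bij \<sigma>"
  shows "procrustes_dist (network_of p) (network_of z) \<le> dist (relabel \<sigma> p) z"
  unfolding procrustes_dist_def
  by (rule Min_le[OF finite_network_dists]) (use assms self_in_network_of[of z] in \<open>auto simp: network_of_def\<close>)

text \<open>Relabellings are isometries, so the one acting on \<open>z\<close> can be undone and a
  single permutation of \<open>p\<close> remains.\<close>

lemma procrustes_dist_attained:
  obtains \<sigma> where "bij \<sigma>" "procrustes_dist (network_of p) (network_of z) = dist (relabel \<sigma> p) z"
proof -
  have "{dist x y |x y. x \<in> network_of p \<and> y \<in> network_of z} \<noteq> {}"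
    using self_in_network_of by blast
  then have "procrustes_dist (network_of p) (network_of z)
      \<in> {dist x y |x y. x \<in> network_of p \<and> y \<in> network_of z}"
    unfolding procrustes_dist_def by (intro Min_in finite_network_dists)
  then obtain \<sigma> \<tau> where st: "bij \<sigma>" "bij \<tau>"
      "procrustes_dist (network_of p) (network_of z) = dist (relabel \<sigma> p) (relabel \<tau> z)"
    by (auto simp: network_of_def)
  have "dist (relabel \<sigma> p) (relabel \<tau> z)
      = dist (relabel (inv \<tau>) (relabel \<sigma> p)) (relabel (inv \<tau>) (relabel \<tau> z))"
    using st by (simp add: dist_relabel bij_imp_bij_inv)
  also have "\<dots> = dist (relabel (inv \<tau> \<circ> \<sigma>) p) z"
    using st by (simp add: relabel_comp relabel_inv bij_imp_bij_inv)
  finally show thesis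
    using that[of "inv \<tau> \<circ> \<sigma>"] st by (simp add: bij_comp bij_imp_bij_inv)
qed

lemma procrustes_dist_nonneg: "0 \<le> procrustes_dist (network_of p) (network_of z)"
  by (metis procrustes_dist_attained zero_le_dist)

text \<open>The permutation optimal for \<open>y\<close> is a competitor for
  \<open>x\<close>.\<close>

lemma procrustes_dist_lipschitz:
  "procrustes_dist (network_of p) (network_of x)
    \<le> procrustes_dist (network_of p) (network_of y) + dist x y"
proof -
  obtain \<sigma> where "bij \<sigma>" "procrustes_dist (network_of p) (network_of y) = dist (relabel \<sigma> p) y"
    by (rule procrustes_dist_attained)
  then show ?thesis
    using procrustes_dist_le[of \<sigma> p x] dist_triangle2[of "relabel \<sigma> p" x y] by (metis add_mono
      dist_commute dist_triangle order.trans)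
qed

lemma continuous_procrustes_dist:
  "continuous_on S (\<lambda>z. procrustes_dist (network_of p) (network_of z))"
  unfolding continuous_on_iff
proof (intro ballI allI impI exI conjI)
  fix x y :: "'a weights" and \<epsilon> :: real assume "dist y x < \<epsilon>"
  then show "dist (procrustes_dist (network_of p) (network_of y))
      (procrustes_dist (network_of p) (network_of x)) < \<epsilon>"
    using procrustes_dist_lipschitz[of p x y] procrustes_dist_lipschitz[of p y x]
    by (simp add: dist_real_def dist_commute)
qed

text \<open>The pullback to the orthant is continuous, so preimages of open sets are open in the
  quotient topology and thus generators of \<open>networks_borel\<close>.\<close>

lemma borel_measurable_procrustes_dist:
  "procrustes_dist (network_of p) \<in> borel_measurable networks_borel"
proof (rule borel_measurableI)
  fix S :: "real set" assume "open S"
  let ?U = "procrustes_dist (network_of p) -` S \<inter> networks"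
  have "{x \<in> orthant. network_of x \<in> ?U}
      = orthant \<inter> (\<lambda>z. procrustes_dist (network_of p) (network_of z)) -` S"
    by (auto simp: networks_def)
  then have "openin networks_topology ?U"
    using \<open>open S\<close> continuous_openin_preimage_gen[OF continuous_procrustes_dist]
    by (auto simp: openin_networks_topology)
  then show "procrustes_dist (network_of p) -` S \<inter> space networks_borel \<in> sets networks_borel"
    unfolding space_networks_borel unfolding networks_borel_def
    by (subst sets_measure_of) (auto simp: openin_networks_topology)
qed

text \<open>The union of all relabelled copies of \<open>S\<close> is a finite union of compact
  sets, hence closed, so the image is closed in the quotient.\<close>

lemma network_of_image_compact_in_sets:
  assumes "compact S" "S \<subseteq> orthant"
  shows "network_of ` S \<in> sets networks_borel"
proof -
  let ?T = "\<Union>\<sigma>\<in>{\<sigma>. bij \<sigma>}. relabel \<sigma> ` S"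
  have "compact ?T"
    using assms by (intro compact_UN compact_continuous_image linear_continuous_on
        linear_conv_bounded_linear[THEN iffD1] linear_relabel) auto
  then have "closed ?T" by (rule compact_imp_closed)
  have "network_of x \<in> network_of ` S \<longleftrightarrow> x \<in> ?T" for x
  proof
    assume "network_of x \<in> network_of ` S"
    then obtain y where "y \<in> S" "network_of x = network_of y" by auto
    then have "x \<in> network_of y" using self_in_network_of by blast
    then show "x \<in> ?T" using \<open>y \<in> S\<close> by (auto simp: network_of_def)
  qed (auto simp: network_of_relabel)
  then have "{x \<in> orthant. network_of x \<in> networks - network_of ` S} = orthant \<inter> - ?T"
    by (auto simp: networks_def)
  then have "openin networks_topology (networks - network_of ` S)"
    using \<open>closed ?T\<close> by (auto simp: openin_networks_topology openin_open)
  then have "networks - network_of ` S \<in> sets networks_borel"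
    unfolding networks_borel_def by (subst sets_measure_of) (auto simp: openin_networks_topology)
  then have "space networks_borel - (networks - network_of ` S) \<in> sets networks_borel"
    by blast
  moreover have "networks - (networks - network_of ` S) = network_of ` S"
    using assms by (auto simp: networks_def)
  ultimately show ?thesis by (simp add: space_networks_borel)
qed

text \<open>Expanding squared distances, a norm that is no larger and an inner product with
  \<open>z\<close> that is no smaller bring \<open>p'\<close> at least as close to
  \<open>z\<close>.\<close>

lemma exists_dominating_distance:
  fixes w p :: "'n::card2 weights"
  assumes "distinct_vec w"
  obtains p' where
    "\<forall>z\<in>cone_about w (min_angle w / 4). dist p' z \<le> procrustes_dist (network_of p) (network_of z)"
    "p' \<in> network_of p \<or> (\<forall>z\<in>cone_about w (min_angle w / 4) - {0}.
        dist p' z < procrustes_dist (network_of p) (network_of z))"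
proof -
  obtain p' where p': "norm p' \<le> norm p"
    "\<forall>\<sigma>. bij \<sigma> \<longrightarrow> (\<forall>z\<in>cone_about w (min_angle w / 4). relabel \<sigma> p \<bullet> z \<le> p' \<bullet> z)"
    "p' \<in> network_of p \<or>
      (\<forall>\<sigma>. bij \<sigma> \<longrightarrow> (\<forall>z\<in>cone_about w (min_angle w / 4) - {0}. relabel \<sigma> p \<bullet> z < p' \<bullet> z))"
    by (rule exists_dominating_weights[OF assms, of p])
  have d: "(dist x z)\<^sup>2 = (norm x)\<^sup>2 - 2 * (x \<bullet> z) + (norm z)\<^sup>2" for x z :: "'n weights"
    unfolding dist_norm power2_norm_eq_inner by (simp add: inner_diff inner_commute)
  have n2: "(norm p')\<^sup>2 \<le> (norm p)\<^sup>2" using p'(1) by (simp add: power_mono)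
  have "dist p' z \<le> dist (relabel \<sigma> p) z" "relabel \<sigma> p \<bullet> z < p' \<bullet> z \<Longrightarrow> dist p' z < dist (relabel \<sigma> p) z"
    if "bij \<sigma>" "z \<in> cone_about w (min_angle w / 4)" for \<sigma> z
  proof -
    have "(dist p' z)\<^sup>2 \<le> (dist (relabel \<sigma> p) z)\<^sup>2"
      unfolding d norm_relabel[OF that(1)] using n2 p'(2)[rule_format, OF that] by linarith
    then show "dist p' z \<le> dist (relabel \<sigma> p) z"
      by (rule power2_le_imp_le) simp
    assume "relabel \<sigma> p \<bullet> z < p' \<bullet> z"
    then have "(dist p' z)\<^sup>2 < (dist (relabel \<sigma> p) z)\<^sup>2"
      unfolding d norm_relabel[OF that(1)] using n2 by linarith
    then show "dist p' z < dist (relabel \<sigma> p) z"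
      by (rule power2_less_imp_less) simp
  qed
  note le = this
  show thesis
  proof (rule that[of p'])
    show "\<forall>z\<in>cone_about w (min_angle w / 4).
        dist p' z \<le> procrustes_dist (network_of p) (network_of z)"
      using le(1) by (metis procrustes_dist_attained)
  next
    show "p' \<in> network_of p \<or> (\<forall>z\<in>cone_about w (min_angle w / 4) - {0}.
        dist p' z < procrustes_dist (network_of p) (network_of z))"
      using p'(3) le(2) by (metis Diff_iff procrustes_dist_attained)
  qed
qed

section \<open>Frechet means\<close>

text \<open>The bias-variance decomposition; boundedness supplies integrability.\<close>

lemma nn_integral_dist_squared:
  fixes c :: "'a::euclidean_space"
  assumes "prob_space Q" and [measurable]: "(\<lambda>z. z) \<in> borel_measurable Q"
    and "AE z in Q. norm z \<le> B"
  defines "m \<equiv> (\<integral>z. z \<partial>Q)"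
  shows "(\<integral>\<^sup>+z. ennreal ((dist c z)\<^sup>2) \<partial>Q)
    = ennreal ((\<integral>z. (dist m z)\<^sup>2 \<partial>Q) + (dist c m)\<^sup>2)"
proof -
  interpret prob_space Q by fact
  have int: "integrable Q (\<lambda>z. z)"
    using assms(3) by (intro integrable_const_bound[where B = B]) auto
  have dint: "integrable Q (\<lambda>z. (dist x z)\<^sup>2)" for x :: 'a
  proof (rule integrable_const_bound[where B = "(norm x + B)\<^sup>2"])
    show "AE z in Q. norm ((dist x z)\<^sup>2) \<le> (norm x + B)\<^sup>2"
      using assms(3)
    proof eventually_elim
      case (elim z)
      have "dist x z \<le> norm x + B"
        using norm_triangle_ineq4[of x z] elim by (simp add: dist_norm)
      then show ?case by (simp add: power_mono)
    qed
  qed measurable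
  \<comment> \<open>Expansion about the mean, where the cross term integrates to zero.\<close>
  have "(\<integral>z. (dist c z)\<^sup>2 \<partial>Q) = (\<integral>z. (dist m z)\<^sup>2 + 2 * ((c - m) \<bullet> (m - z)) + (dist c m)\<^sup>2 \<partial>Q)"
    by (intro Bochner_Integration.integral_cong)
       (simp_all add: dist_norm power2_norm_eq_inner inner_diff inner_commute algebra_simps)
  also have "\<dots> = (\<integral>z. (dist m z)\<^sup>2 \<partial>Q) + 2 * ((c - m) \<bullet> (m - (\<integral>z. z \<partial>Q))) + (dist c m)\<^sup>2"
    using int dint[of m] by (simp add: prob_space)
  finally have "(\<integral>z. (dist c z)\<^sup>2 \<partial>Q) = (\<integral>z. (dist m z)\<^sup>2 \<partial>Q) + (dist c m)\<^sup>2"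
    by (simp add: m_def)
  then show ?thesis
    using dint[of c] by (simp add: nn_integral_eq_integral)
qed

lemma center_of_mass_eq_integral:
  assumes "AE z in Q. z \<in> K" "K \<in> sets Q" "(\<lambda>z. z) \<in> borel_measurable Q"
  shows "center_of_mass K Q = (\<integral>z. z \<partial>Q)"
  unfolding center_of_mass_def set_lebesgue_integral_def
proof (rule integral_cong_AE)
  show "AE z in Q. indicat_real K z *\<^sub>R z = z"
    using assms(1) by eventually_elim simp
qed (use assms in measurable)

theorem theorem4p5:
  fixes w :: "'n::card2 weights"
    and K :: "'n weights set set"
    and K' :: "'n weights set"
    and Q :: "'n weights measure"
  assumes "distinct_vec w"
    and "K \<subseteq> networks"
    and "compact K'" and "convex K'" and "K' \<subseteq> cone_about w (min_angle w / 4)"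
    and "homeomorphic_map (top_of_set K') (subtopology networks_topology K) network_of"
    and "prob_space Q" and "sets Q = sets (restrict_space borel orthant)" and "emeasure Q K' = 1"
  shows "emeasure (distr Q networks_borel network_of) K = 1
    \<and> (\<exists>!\<mu>. is_frechet_mean networks procrustes_dist (distr Q networks_borel network_of) \<mu>)
    \<and> is_frechet_mean networks procrustes_dist (distr Q networks_borel network_of)
         (network_of (center_of_mass K' Q))"
proof -
  interpret prob_space Q by fact
  let ?C = "cone_about w (min_angle w / 4)"
  let ?P = "distr Q networks_borel network_of"
  let ?F = "frechet_function procrustes_dist ?P"
  have K'O: "K' \<subseteq> orthant" using assms(5) by (auto simp: cone_about_def)
  have spQ: "space Q = orthant"
    using sets_eq_imp_space_eq[OF assms(8)] by (simp add: space_restrict_space)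
  \<comment> \<open>A non-measurable set would have \<open>emeasure\<close> 0, not 1.\<close>
  have K'Q: "K' \<in> sets Q"
    using assms(9) emeasure_notin_sets by force
  have meas_id [measurable]: "(\<lambda>z. z) \<in> borel_measurable Q"
    unfolding measurable_cong_sets[OF assms(8) refl] by (intro measurable_restrict_space1) simp
  have meas [measurable]: "network_of \<in> Q \<rightarrow>\<^sub>M networks_borel"
    using measurable_network_of unfolding measurable_cong_sets[OF assms(8) refl] .
  have "prob K' = 1" using assms(9) by (simp add: measure_def)
  then have AEK': "AE z in Q. z \<in> K'"
    using K'Q by (simp add: prob_eq_1)
  then have AEC: "AE z in Q. z \<in> ?C" using assms(5) by (auto elim: eventually_mono)
  obtain B where "\<And>z. z \<in> K' \<Longrightarrow> norm z \<le> B"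
    using compact_imp_bounded[OF assms(3)] by (auto simp: bounded_iff)
  then have AEB: "AE z in Q. norm z \<le> B" using AEK' by (auto elim: eventually_mono)

  have "network_of ` topspace (top_of_set K') = topspace (subtopology networks_topology K)"
    using assms(6) by (rule homeomorphic_imp_surjective_map)
  then have K: "K = network_of ` K'"
    using assms(2) by (simp add: topspace_networks_topology Int_absorb1)
  have K_sets: "K \<in> sets networks_borel"
    unfolding K by (rule network_of_image_compact_in_sets[OF assms(3) K'O])
  have "emeasure ?P K = emeasure Q (network_of -` K \<inter> space Q)"
    by (rule emeasure_distr[OF meas K_sets])
  \<comment> \<open>The preimage of \<open>K\<close> also contains the other relabellings of
    \<open>K'\<close>, so it only includes \<open>K'\<close>; total mass 1 gives the reverse
    bound.\<close>
  moreover have "emeasure Q K' \<le> emeasure Q (network_of -` K \<inter> space Q)"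
    using measurable_sets[OF meas K_sets] K'O by (intro emeasure_mono) (auto simp: K spQ)
  ultimately have P_K: "emeasure ?P K = 1"
    using assms(9) measure_le_1 by (simp add: antisym)

  define \<mu> where "\<mu> = (\<integral>z. z \<partial>Q)"
  define V where "V = (\<integral>z. (dist \<mu> z)\<^sup>2 \<partial>Q)"
  have V0: "0 \<le> V" by (simp add: V_def)
  have com: "center_of_mass K' Q = \<mu>"
    unfolding \<mu>_def by (rule center_of_mass_eq_integral[OF AEK' K'Q meas_id])
  have E: "(\<integral>\<^sup>+z. ennreal ((dist c z)\<^sup>2) \<partial>Q) = ennreal (V + (dist c \<mu>)\<^sup>2)" for c
    unfolding V_def \<mu>_def by (rule nn_integral_dist_squared[OF assms(7) meas_id AEB])
  \<comment> \<open>Being in the orthant makes the orbit of \<open>\<mu>\<close> an admissible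
    network.\<close>
  have "0 \<le> \<mu> $ e" for e
  proof -
    have int: "integrable Q (\<lambda>z. z)"
      using AEB by (intro integrable_const_bound[where B = B]) auto
    have "\<mu> $ e = (\<integral>z. z $ e \<partial>Q)"
      unfolding \<mu>_def by (rule integral_bounded_linear[OF bounded_linear_vec_nth int, symmetric])
    also have "0 \<le> \<dots>"
      by (rule Bochner_Integration.integral_nonneg_AE)
         (use AEK' K'O in \<open>auto simp: orthant_def elim!: eventually_mono\<close>)
    finally show ?thesis .
  qed
  then have \<mu>O: "\<mu> \<in> orthant" by (simp add: orthant_def)

  have F: "?F (network_of p) = (\<integral>\<^sup>+z. ennreal ((procrustes_dist (network_of p) (network_of z))\<^sup>2) \<partial>Q)" for p
    unfolding frechet_function_def
    by (rule nn_integral_distr[OF meas]) (use borel_measurable_procrustes_dist in measurable)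
  have measp [measurable]:
    "(\<lambda>z. procrustes_dist (network_of p) (network_of z)) \<in> borel_measurable Q" for p
    using measurable_compose[OF meas borel_measurable_procrustes_dist] .
  have F\<mu>: "?F (network_of \<mu>) \<le> ennreal V"
  proof -
    have "procrustes_dist (network_of \<mu>) (network_of z) \<le> dist \<mu> z" for z
      using procrustes_dist_le[OF bij_id, of \<mu> z] by (simp only: relabel_id)
    then have "?F (network_of \<mu>) \<le> (\<integral>\<^sup>+z. ennreal ((dist \<mu> z)\<^sup>2) \<partial>Q)"
      unfolding F by (intro nn_integral_mono ennreal_leI power_mono procrustes_dist_nonneg)
    then show ?thesis unfolding E by simp
  qed
  \<comment> \<open>The vector \<open>p'\<close> bounds the Frechet function at \<open>p\<close>
    below by V plus the squared distance from \<open>p'\<close> to \<open>\<mu>\<close>. This gives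
    minimality, and a tie forces \<open>p' = \<mu>\<close>.\<close>
  have key: "ennreal V \<le> ?F (network_of p)
      \<and> (?F (network_of p) \<le> ennreal V \<longrightarrow> network_of p = network_of \<mu>)" for p
  proof -
    obtain p' where p': "\<forall>z\<in>?C. dist p' z \<le> procrustes_dist (network_of p) (network_of z)"
      "p' \<in> network_of p \<or> (\<forall>z\<in>?C - {0}.
        dist p' z < procrustes_dist (network_of p) (network_of z))"
      by (rule exists_dominating_distance[OF assms(1), of p])
    have le: "AE z in Q. ennreal ((dist p' z)\<^sup>2)
        \<le> ennreal ((procrustes_dist (network_of p) (network_of z))\<^sup>2)"
      using AEC p'(1) by (auto elim!: eventually_mono intro!: ennreal_leI power_mono)
    have lower: "ennreal (V + (dist p' \<mu>)\<^sup>2) \<le> ?F (network_of p)"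
      using nn_integral_mono_AE[OF le] unfolding E F .
    have "network_of p = network_of \<mu>" if Fp: "?F (network_of p) \<le> ennreal V"
    proof -
      have "ennreal (V + (dist p' \<mu>)\<^sup>2) \<le> ennreal V" using lower Fp by (rule order_trans)
      then have p'\<mu>: "p' = \<mu>" using V0 by (simp add: ennreal_le_iff)
      show ?thesis
        using p'(2)
      proof
        assume "p' \<in> network_of p"
        then obtain \<sigma> where "bij \<sigma>" "\<mu> = relabel \<sigma> p"
          using p'\<mu> by (auto simp: network_of_def)
        then show ?thesis using network_of_relabel by metis
      next
        assume strict: "\<forall>z\<in>?C - {0}. dist p' z < procrustes_dist (network_of p) (network_of z)"
        \<comment> \<open>A strict gain on a set of positive measure would push the Frechet function
          at \<open>p\<close> above V. Hence the strict alternative leaves \<open>Q\<close> no mass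
          outside 0.\<close>
        have "AE z in Q. ennreal ((procrustes_dist (network_of p) (network_of z))\<^sup>2)
            \<le> ennreal ((dist p' z)\<^sup>2)"
        proof (rule ccontr)
          assume "\<not> ?thesis"
          then have "(\<integral>\<^sup>+z. ennreal ((dist p' z)\<^sup>2) \<partial>Q) < ?F (network_of p)"
            unfolding F by (intro nn_integral_less le) (auto simp: E)
          then show False using Fp unfolding E p'\<mu> by simp
        qed
        then have AE0: "AE z in Q. z = 0"
          using AEC
        proof eventually_elim
          case (elim z)
          then have "procrustes_dist (network_of p) (network_of z) \<le> dist p' z"
            by (simp add: ennreal_le_iff procrustes_dist_nonneg)
          then show ?case using strict elim by force
        qed
        \<comment> \<open>For the point mass at 0 both \<open>\<mu>\<close> and \<open>V\<close>
          vanish, and the Frechet function at \<open>p\<close> is the squared norm of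
          \<open>p\<close>, so \<open>p = 0\<close>.\<close>
        have "\<mu> = (\<integral>z. 0 \<partial>Q)"
          unfolding \<mu>_def using AE0 by (intro integral_cong_AE) auto
        then have \<mu>0: "\<mu> = 0" by simp
        have "V = (\<integral>z. 0 \<partial>Q)"
          unfolding V_def using AE0 \<mu>0 by (intro integral_cong_AE) (auto elim: eventually_mono)
        then have "?F (network_of p) = 0" using Fp by simp
        moreover have "?F (network_of p) = (\<integral>\<^sup>+z. ennreal ((norm p)\<^sup>2) \<partial>Q)"
          unfolding F
        proof (rule nn_integral_cong_AE)
          have "procrustes_dist (network_of p) (network_of 0) = norm p"
            by (metis dist_0_norm dist_commute norm_relabel procrustes_dist_attained)
          then show "AE z in Q. ennreal ((procrustes_dist (network_of p) (network_of z))\<^sup>2)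
              = ennreal ((norm p)\<^sup>2)"
            using AE0 by (auto elim: eventually_mono)
        qed
        ultimately have "p = 0" by (simp add: emeasure_space_1)
        then show ?thesis using \<mu>0 by simp
      qed
    qed
    then show ?thesis using lower V0 by (auto intro: order_trans[rotated] ennreal_leI)
  qed
  have mean: "is_frechet_mean networks procrustes_dist ?P (network_of \<mu>)"
    using \<mu>O F\<mu> key unfolding is_frechet_mean_def networks_def by (blast intro: order_trans)
  moreover have "X = network_of \<mu>" if X: "is_frechet_mean networks procrustes_dist ?P X" for X
  proof -
    obtain p where p: "X = network_of p"
      using X by (auto simp: is_frechet_mean_def networks_def)
    have "?F X \<le> ?F (network_of \<mu>)"
      using X \<mu>O by (auto simp: is_frechet_mean_def networks_def)
    then show ?thesis using key[of p] F\<mu> p by (meson order_trans)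
  qed
  ultimately show ?thesis using P_K com by metis
qed

end
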